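(* Let $(L,A,\cdot,\ell)$ be a left-symmetric Rinehart algebra over a field $\mathbb K$ of characteristic zero, $(M;\rho,\mu)$ a representation of it, $T:M\to L$ an $\mathcal O$-operator on $(L,A,\cdot,\ell)$ associated to $(M;\rho,\mu)$, and $N$ a Nijenhuis operator on $(L,A,\cdot,\ell)$. Then $N\circ T$ is an $\mathcal O$-operator on $(L,A,\cdot,\ell)$ associated to $(M;\rho,\mu)$ if and only if for all $u,v\in M$ $$N\Big(NT(u)\cdot T(v)+T(u)\cdot NT(v)\Big)=N\Big(T\big(\rho(NT(u))(v)+\mu(NT(v))(u)\big)+NT\big(\rho(T(u))(v)+\mu(T(v))(u)\big)\Big).$$ If, in addition, $N$ is invertible (and $N\circ T$ is an $\mathcal O$-operator), then $T$ and $NT$ are compatible. More explicitly, for any $\mathcal O$-operator $T$, if there exists an invertible Nijenhuis operator $N$ such that $NT$ is also an $\mathcal O$-operator, then $T$ and $NT$ are compatible.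
   Context: All vector spaces are over a field $\mathbb K$ of characteristic zero. A left-symmetric Rinehart algebra is a quadruple $(L,A,\cdot,\ell)$ where $A$ is an associative commutative $\mathbb K$-algebra, $L$ is an $A$-module with a bilinear product satisfying $(x\cdot y)\cdot z-x\cdot(y\cdot z)=(y\cdot x)\cdot z-y\cdot(x\cdot z)$, and $\ell:L\to \mathrm{Der}(A)$ is a linear map such that $\ell(x\cdot y-y\cdot x)=\ell(x)\ell(y)-\ell(y)\ell(x)$, $\ell(ax)=a\ell(x)$, $x\cdot(ay)=\ell(x)(a)\,y+a(x\cdot y)$, and $(ax)\cdot y=a(x\cdot y)$ for all $a\in A$, $x,y,z\in L$. Write $[x,y]=x\cdot y-y\cdot x$. A representation $(M;\rho,\mu)$ of $(L,A,\cdot,\ell)$ consists of an $A$-module $M$, a linear map $\rho:L\to\mathrm{End}_{\mathbb K}(M)$ with $\rho([x,y])=\rho(x)\rho(y)-\rho(y)\rho(x)$, $\rho(ax)m=a\rho(x)m$, $\rho(x)(am)=a\rho(x)m+\ell(x)(a)m$, and a linear map $\mu:L\to \mathrm{End}_{\mathbb K}(M)$ with $\mu(ax)m=a\mu(x)m=\mu(x)(am)$ and $\rho(x)\mu(y)-\mu(y)\rho(x)=\mu(x\cdot y)-\mu(y)\mu(x)$. An $\mathcal O$-operator associated to $(M;\rho,\mu)$ is a linear map $T:M\to L$ with $T(au)=aT(u)$ and $T(u)\cdot T(v)=T(\rho(T(u))(v)+\mu(T(v))(u))$ for all $u,v\in M$, $a\in A$. Two $\mathcal O$-operators $T_1,T_2$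 associated to $(M;\rho,\mu)$ are compatible if $T_1+T_2$ is an $\mathcal O$-operator associated to $(M;\rho,\mu)$. A Nijenhuis operator on $(L,A,\cdot,\ell)$ is an $A$-linear map $N:L\to L$ with $N(x)\cdot N(y)-N(x\cdot N(y))-N(N(x)\cdot y)+N^2(x\cdot y)=0$ for all $x,y\in L$. *)

theory Defs
  imports Complex_Main
begin

text \<open>
  Each of the spaces is a whole type. The scalar multiplications by the ground field are written
  \<open>sA\<close>, \<open>sL\<close>, \<open>sM\<close>, the actions of the algebra on its modules \<open>aL\<close>, \<open>aM\<close>.
  The algebra is not assumed to have a unit, so the scalar multiplication on a module is
  not determined by the action and is kept as separate data, compatible with it.
\<close>

text \<open>Equivalently: \<open>f\<close> is a linear map from the first space into the linear maps from the second
  space to the third. This is how linear maps into \<open>Der(A)\<close> and \<open>End(M)\<close> are rendered below.\<close>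

definition K_bilinear ::
  "('k::field \<Rightarrow> 'u::ab_group_add \<Rightarrow> 'u) \<Rightarrow> ('k \<Rightarrow> 'v::ab_group_add \<Rightarrow> 'v) \<Rightarrow>
   ('k \<Rightarrow> 'w::ab_group_add \<Rightarrow> 'w) \<Rightarrow> ('u \<Rightarrow> 'v \<Rightarrow> 'w) \<Rightarrow> bool" where
  "K_bilinear sU sV sW f \<longleftrightarrow>
     (\<forall>x. Vector_Spaces.linear sV sW (f x)) \<and> (\<forall>y. Vector_Spaces.linear sU sW (\<lambda>x. f x y))"

text \<open>Associativity and commutativity of the product are part of the class \<open>comm_ring\<close>.\<close>

locale comm_assoc_algebra = vector_space sA
  for sA :: "'k::field_char_0 \<Rightarrow> 'a::comm_ring \<Rightarrow> 'a" +
  assumes mult_bilinear: "K_bilinear sA sA sA (*)"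

locale algebra_module = A: comm_assoc_algebra sA + V: vector_space sV
  for sA :: "'k::field_char_0 \<Rightarrow> 'a::comm_ring \<Rightarrow> 'a"
    and sV :: "'k \<Rightarrow> 'v::ab_group_add \<Rightarrow> 'v" +
  fixes aV :: "'a \<Rightarrow> 'v \<Rightarrow> 'v"
  assumes act_bilinear: "K_bilinear sA sV sV aV"
    and act_act: "aV (a * b) x = aV a (aV b x)"

definition derivation :: "('k::field \<Rightarrow> 'a::comm_ring \<Rightarrow> 'a) \<Rightarrow> ('a \<Rightarrow> 'a) \<Rightarrow> bool" where
  "derivation sA D \<longleftrightarrow> Vector_Spaces.linear sA sA D \<and> (\<forall>a b. D (a * b) = D a * b + a * D b)"

definition A_linear ::
  "('k::field \<Rightarrow> 'v::ab_group_add \<Rightarrow> 'v) \<Rightarrow> ('a \<Rightarrow> 'v \<Rightarrow> 'v) \<Rightarrow>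
   ('k \<Rightarrow> 'w::ab_group_add \<Rightarrow> 'w) \<Rightarrow> ('a \<Rightarrow> 'w \<Rightarrow> 'w) \<Rightarrow> ('v \<Rightarrow> 'w) \<Rightarrow> bool" where
  "A_linear sV aV sW aW f \<longleftrightarrow>
     Vector_Spaces.linear sV sW f \<and> (\<forall>a x. f (aV a x) = aW a (f x))"

locale left_symmetric_Rinehart_algebra = L: algebra_module sA sL aL
  for sA :: "'k::field_char_0 \<Rightarrow> 'a::comm_ring \<Rightarrow> 'a"
    and sL :: "'k \<Rightarrow> 'l::ab_group_add \<Rightarrow> 'l"
    and aL :: "'a \<Rightarrow> 'l \<Rightarrow> 'l" +
  fixes mulL :: "'l \<Rightarrow> 'l \<Rightarrow> 'l"  (infixl "\<cdot>" 70)
    and ell :: "'l \<Rightarrow> 'a \<Rightarrow> 'a"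
  assumes prod_bilinear: "K_bilinear sL sL sL (\<cdot>)"
    and left_symmetric: "(x \<cdot> y) \<cdot> z - x \<cdot> (y \<cdot> z) = (y \<cdot> x) \<cdot> z - y \<cdot> (x \<cdot> z)"
    and ell_derivation: "derivation sA (ell x)"
    and ell_linear: "K_bilinear sL sA sA ell"
    and ell_commutator: "ell (x \<cdot> y - y \<cdot> x) a = ell x (ell y a) - ell y (ell x a)"
    and ell_act: "ell (aL a x) b = a * ell x b"
    and prod_act_right: "x \<cdot> aL a y = aL (ell x a) y + aL a (x \<cdot> y)"
    and prod_act_left: "aL a x \<cdot> y = aL a (x \<cdot> y)"

locale LSR_representation =
  left_symmetric_Rinehart_algebra sA sL aL mulL ell + M: algebra_module sA sM aM
  for sA :: "'k::field_char_0 \<Rightarrow> 'a::comm_ring \<Rightarrow> 'a"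
    and sL :: "'k \<Rightarrow> 'l::ab_group_add \<Rightarrow> 'l"
    and aL :: "'a \<Rightarrow> 'l \<Rightarrow> 'l"
    and mulL :: "'l \<Rightarrow> 'l \<Rightarrow> 'l"  (infixl "\<cdot>" 70)
    and ell :: "'l \<Rightarrow> 'a \<Rightarrow> 'a"
    and sM :: "'k \<Rightarrow> 'm::ab_group_add \<Rightarrow> 'm"
    and aM :: "'a \<Rightarrow> 'm \<Rightarrow> 'm" +
  fixes rho :: "'l \<Rightarrow> 'm \<Rightarrow> 'm"
    and mu :: "'l \<Rightarrow> 'm \<Rightarrow> 'm"
  assumes rho_linear: "K_bilinear sL sM sM rho"
    and rho_commutator: "rho (x \<cdot> y - y \<cdot> x) m = rho x (rho y m) - rho y (rho x m)"
    and rho_act_left: "rho (aL a x) m = aM a (rho x m)"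
    and rho_act_right: "rho x (aM a m) = aM a (rho x m) + aM (ell x a) m"
    and mu_linear: "K_bilinear sL sM sM mu"
    and mu_act_left: "mu (aL a x) m = aM a (mu x m)"
    and mu_act_right: "mu x (aM a m) = aM a (mu x m)"
    and rho_mu: "rho x (mu y m) - mu y (rho x m) = mu (x \<cdot> y) m - mu y (mu x m)"

definition O_operator ::
  "('k::field \<Rightarrow> 'l::ab_group_add \<Rightarrow> 'l) \<Rightarrow> ('a \<Rightarrow> 'l \<Rightarrow> 'l) \<Rightarrow> ('l \<Rightarrow> 'l \<Rightarrow> 'l) \<Rightarrow>
   ('k \<Rightarrow> 'm::ab_group_add \<Rightarrow> 'm) \<Rightarrow> ('a \<Rightarrow> 'm \<Rightarrow> 'm) \<Rightarrow>
   ('l \<Rightarrow> 'm \<Rightarrow> 'm) \<Rightarrow> ('l \<Rightarrow> 'm \<Rightarrow> 'm) \<Rightarrow> ('m \<Rightarrow> 'l) \<Rightarrow> bool" where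
  "O_operator sL aL mulL sM aM rho mu T \<longleftrightarrow>
     A_linear sM aM sL aL T \<and>
     (\<forall>u v. mulL (T u) (T v) = T (rho (T u) v + mu (T v) u))"

definition compatible_O_operators ::
  "('k::field \<Rightarrow> 'l::ab_group_add \<Rightarrow> 'l) \<Rightarrow> ('a \<Rightarrow> 'l \<Rightarrow> 'l) \<Rightarrow> ('l \<Rightarrow> 'l \<Rightarrow> 'l) \<Rightarrow>
   ('k \<Rightarrow> 'm::ab_group_add \<Rightarrow> 'm) \<Rightarrow> ('a \<Rightarrow> 'm \<Rightarrow> 'm) \<Rightarrow>
   ('l \<Rightarrow> 'm \<Rightarrow> 'm) \<Rightarrow> ('l \<Rightarrow> 'm \<Rightarrow> 'm) \<Rightarrow> ('m \<Rightarrow> 'l) \<Rightarrow> ('m \<Rightarrow> 'l) \<Rightarrow> bool" where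
  "compatible_O_operators sL aL mulL sM aM rho mu T1 T2 \<longleftrightarrow>
     O_operator sL aL mulL sM aM rho mu T1 \<and>
     O_operator sL aL mulL sM aM rho mu T2 \<and>
     O_operator sL aL mulL sM aM rho mu (\<lambda>u. T1 u + T2 u)"

definition Nijenhuis_operator ::
  "('k::field \<Rightarrow> 'l::ab_group_add \<Rightarrow> 'l) \<Rightarrow> ('a \<Rightarrow> 'l \<Rightarrow> 'l) \<Rightarrow> ('l \<Rightarrow> 'l \<Rightarrow> 'l) \<Rightarrow>
   ('l \<Rightarrow> 'l) \<Rightarrow> bool" where
  "Nijenhuis_operator sL aL mulL N \<longleftrightarrow>
     A_linear sL aL sL aL N \<and>
     (\<forall>x y. mulL (N x) (N y) - N (mulL x (N y)) - N (mulL (N x) y) + N (N (mulL x y)) = 0)"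

end

theory Submission
  imports Defs
begin

text \<open>
  Expanding \<open>NT(u) \<cdot> NT(v)\<close> by the Nijenhuis identity and \<open>T(u) \<cdot> T(v)\<close> by the
  \<open>\<O>\<close>-operator identity turns the \<open>\<O>\<close>-operator condition for \<open>NT\<close> into the displayed equation.
  Cancelling the outer \<open>N\<close> in it leaves exactly the identity between the mixed terms in the
  expansion of the \<open>\<O>\<close>-operator condition for \<open>T + NT\<close>.
\<close>

lemma linear_additive:
  assumes "Vector_Spaces.linear s1 s2 f"
  shows "f (x + y) = f x + f y"
  using assms by (simp add: Vector_Spaces.linear_iff)

lemma K_bilinear_add_left:
  assumes "K_bilinear sU sV sW f"
  shows "f (x + x') y = f x y + f x' y"
proof -
  have "Vector_Spaces.linear sU sW (\<lambda>x. f x y)"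
    using assms by (simp add: K_bilinear_def)
  from linear_additive[OF this] show ?thesis .
qed

lemma K_bilinear_add_right:
  assumes "K_bilinear sU sV sW f"
  shows "f x (y + y') = f x y + f x y'"
  using assms linear_additive unfolding K_bilinear_def by metis

lemma A_linear_additive:
  assumes "A_linear sV aV sW aW f"
  shows "f (x + y) = f x + f y"
  using assms linear_additive unfolding A_linear_def by metis

lemma A_linear_comp:
  assumes "A_linear sU aU sV aV f" and "A_linear sV aV sW aW g"
  shows "A_linear sU aU sW aW (g \<circ> f)"
  using assms by (auto simp: A_linear_def intro: Vector_Spaces.linear_compose)

text \<open>The locale module is the target, since distributivity of its scalar multiplication and
  of its action makes a pointwise sum A-linear.\<close>

lemma (in algebra_module) A_linear_add:
  assumes f: "A_linear sU aU sV aV f" and g: "A_linear sU aU sV aV g"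
  shows "A_linear sU aU sV aV (\<lambda>x. f x + g x)"
  using f g K_bilinear_add_right[OF act_bilinear]
  by (auto simp: A_linear_def Vector_Spaces.linear_iff V.scale_right_distrib)

text \<open>Solved for the product of two images, the identity serves as a rewrite rule.\<close>

lemma Nijenhuis_operator_mult:
  assumes "Nijenhuis_operator sL aL mulL N"
  shows "mulL (N x) (N y) = N (mulL x (N y)) + N (mulL (N x) y) - N (N (mulL x y))"
proof -
  have "mulL (N x) (N y) - N (mulL x (N y)) - N (mulL (N x) y) + N (N (mulL x y)) = 0"
    using assms unfolding Nijenhuis_operator_def by blast
  then show ?thesis
    by (simp add: algebra_simps add_eq_0_iff2)
qed

lemma O_operator_mult:
  assumes "O_operator sL aL mulL sM aM rho mu T"
  shows "mulL (T u) (T v) = T (rho (T u) v + mu (T v) u)"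
  using assms unfolding O_operator_def by blast

context LSR_representation
begin

lemma O_operator_Nijenhuis_comp_iff:
  assumes T: "O_operator sL aL (\<cdot>) sM aM rho mu T"
    and N: "Nijenhuis_operator sL aL (\<cdot>) N"
  shows "O_operator sL aL (\<cdot>) sM aM rho mu (N \<circ> T) \<longleftrightarrow>
    (\<forall>u v. N (N (T u) \<cdot> T v + T u \<cdot> N (T v)) =
           N (T (rho (N (T u)) v + mu (N (T v)) u) + N (T (rho (T u) v + mu (T v) u))))"
proof -
  have Tl: "A_linear sM aM sL aL T" and Nl: "A_linear sL aL sL aL N"
    using T N by (simp_all add: O_operator_def Nijenhuis_operator_def)
  note N_add = A_linear_additive[OF Nl]
  have "N (T u) \<cdot> N (T v) = N (T (rho (N (T u)) v + mu (N (T v)) u)) \<longleftrightarrow>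
      N (N (T u) \<cdot> T v + T u \<cdot> N (T v)) =
      N (T (rho (N (T u)) v + mu (N (T v)) u) + N (T (rho (T u) v + mu (T v) u)))" for u v
    \<comment> \<open>The negative term \<open>N (N (T u \<cdot> T v))\<close> becomes
      \<open>N (N (T (rho (T u) v + mu (T v) u)))\<close>; moving it to the other side gives the
      displayed equation.\<close>
    unfolding Nijenhuis_operator_mult[OF N] O_operator_mult[OF T] N_add
    by (simp add: diff_eq_eq add.commute)
  \<comment> \<open>A-linearity of \<open>N \<circ> T\<close> is automatic, so only the product
    identity, just treated for each pair \<open>u\<close>, \<open>v\<close>, has to be
    compared.\<close>
  then show ?thesis
    using A_linear_comp[OF Tl Nl] by (simp add: O_operator_def)
qed

text \<open>The defect of the product identity is quadratic in the operator. For a sum of two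
  solutions only its polarised part can survive, and \<open>mixed\<close> says that this part
  vanishes.\<close>

lemma compatible_O_operators_Nijenhuis_comp:
  assumes T: "O_operator sL aL (\<cdot>) sM aM rho mu T"
    and N: "Nijenhuis_operator sL aL (\<cdot>) N"
    and "inj N"
    and NT: "O_operator sL aL (\<cdot>) sM aM rho mu (N \<circ> T)"
  shows "compatible_O_operators sL aL (\<cdot>) sM aM rho mu T (N \<circ> T)"
proof -
  have Tl: "A_linear sM aM sL aL T" and Nl: "A_linear sL aL sL aL N"
    using T N by (simp_all add: O_operator_def Nijenhuis_operator_def)
  \<comment> \<open>The operators enter \<open>rho\<close> and \<open>mu\<close> through the first
    argument, but the product through both.\<close>
  note additive = A_linear_additive[OF Tl] A_linear_additive[OF Nl]
    K_bilinear_add_left[OF prod_bilinear] K_bilinear_add_right[OF prod_bilinear]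
    K_bilinear_add_left[OF rho_linear] K_bilinear_add_left[OF mu_linear]
  have "(T u + N (T u)) \<cdot> (T v + N (T v)) =
      T (rho (T u + N (T u)) v + mu (T v + N (T v)) u) +
      N (T (rho (T u + N (T u)) v + mu (T v + N (T v)) u))" for u v
  proof -
    have mixed: "N (T u) \<cdot> T v + T u \<cdot> N (T v) =
        T (rho (N (T u)) v + mu (N (T v)) u) + N (T (rho (T u) v + mu (T v) u))"
      \<comment> \<open>Both sides of the criterion are values of \<open>N\<close>, so injectivity
        removes the outer \<open>N\<close>.\<close>
      using O_operator_Nijenhuis_comp_iff[OF T N] NT \<open>inj N\<close> by (blast dest: injD)
    have "(T u + N (T u)) \<cdot> (T v + N (T v)) =
        T u \<cdot> T v + (N (T u) \<cdot> T v + T u \<cdot> N (T v)) + N (T u) \<cdot> N (T v)"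
      by (simp add: additive algebra_simps)
    \<comment> \<open>The three groups are replaced by the identity for \<open>T\<close>, by
      \<open>mixed\<close> and by the identity for \<open>N \<circ> T\<close>, in this
      order.\<close>
    also have "\<dots> = T (rho (T u) v + mu (T v) u) +
        (T (rho (N (T u)) v + mu (N (T v)) u) + N (T (rho (T u) v + mu (T v) u))) +
        N (T (rho (N (T u)) v + mu (N (T v)) u))"
      using O_operator_mult[OF T, of u v] O_operator_mult[OF NT, of u v] mixed by simp
    finally show ?thesis
      by (simp add: additive algebra_simps)
  qed
  moreover have "A_linear sM aM sL aL (\<lambda>u. T u + (N \<circ> T) u)"
    using L.A_linear_add[OF Tl A_linear_comp[OF Tl Nl]] .
  ultimately have "O_operator sL aL (\<cdot>) sM aM rho mu (\<lambda>u. T u + (N \<circ> T) u)"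
    by (simp add: O_operator_def)
  with T NT show ?thesis
    by (simp add: compatible_O_operators_def)
qed

end

theorem proposition7p10:
  fixes sA :: "'k::field_char_0 \<Rightarrow> 'a::comm_ring \<Rightarrow> 'a"
    and sL :: "'k \<Rightarrow> 'l::ab_group_add \<Rightarrow> 'l"
    and aL :: "'a \<Rightarrow> 'l \<Rightarrow> 'l"
    and mulL :: "'l \<Rightarrow> 'l \<Rightarrow> 'l"  (infixl "\<cdot>" 70)
    and ell :: "'l \<Rightarrow> 'a \<Rightarrow> 'a"
    and sM :: "'k \<Rightarrow> 'm::ab_group_add \<Rightarrow> 'm"
    and aM :: "'a \<Rightarrow> 'm \<Rightarrow> 'm"
    and rho mu :: "'l \<Rightarrow> 'm \<Rightarrow> 'm"
    and T :: "'m \<Rightarrow> 'l"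
    and N :: "'l \<Rightarrow> 'l"
  assumes "left_symmetric_Rinehart_algebra sA sL aL (\<cdot>) ell"
    and "LSR_representation sA sL aL (\<cdot>) ell sM aM rho mu"
    and "O_operator sL aL (\<cdot>) sM aM rho mu T"
    and "Nijenhuis_operator sL aL (\<cdot>) N"
  shows
    "(O_operator sL aL (\<cdot>) sM aM rho mu (N \<circ> T) \<longleftrightarrow>
        (\<forall>u v. N (N (T u) \<cdot> T v + T u \<cdot> N (T v)) =
               N (T (rho (N (T u)) v + mu (N (T v)) u) + N (T (rho (T u) v + mu (T v) u)))))
     \<and> (bij N \<and> O_operator sL aL (\<cdot>) sM aM rho mu (N \<circ> T) \<longrightarrow>
          compatible_O_operators sL aL (\<cdot>) sM aM rho mu T (N \<circ> T))
     \<and> (\<forall>T'. O_operator sL aL (\<cdot>) sM aM rho mu T' \<longrightarrow>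
          (\<forall>N'. Nijenhuis_operator sL aL (\<cdot>) N' \<and> bij N' \<and>
                 O_operator sL aL (\<cdot>) sM aM rho mu (N' \<circ> T') \<longrightarrow>
               compatible_O_operators sL aL (\<cdot>) sM aM rho mu T' (N' \<circ> T')))"
proof -
  interpret LSR_representation sA sL aL mulL ell sM aM rho mu
    by fact
  show ?thesis
    \<comment> \<open>The compatibility lemma stays general, to be instantiated at \<open>T\<close>,
      \<open>N\<close> and at arbitrary \<open>T'\<close>, \<open>N'\<close>; bijectivity supplies
      the injectivity it asks for.\<close>
    using O_operator_Nijenhuis_comp_iff[OF assms(3,4)] assms(3,4)
      compatible_O_operators_Nijenhuis_comp bij_is_inj by blast
qed

end
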